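(* Let $A$ be a non-negative reducible square matrix of order $N$ with no zero row, of the form $$A=\begin{pmatrix}\mathbf{0}&B\\ \mathbf{0}&A_2\end{pmatrix},$$ where $A_2$ is a non-negative irreducible square matrix of order $n_2$ and $B$ is a non-negative matrix of size $n_1\times n_2$, with $n_1+n_2=N$. Let $P_A$ and $P_{A_2}$ be the row-normalizations of $A$ and $A_2$, respectively. Fix $\lambda\in(0,1)$ and let $X(\lambda)=(1-\lambda)(I_N-\lambda P_A)^{-1}$. Then for any personalization vector $\mathbf{v}\in\mathbb{R}^{N\times1}$ with $\|\mathbf{v}\|_1=1$, the recursive sequence $\{\mathbf{x}_k\}_{k\ge0}\subset\mathbb{R}^{N\times1}$ with $\mathbf{x}_0=\mathbf{v}$ defined by $$\mathbf{x}_k^T=\mathbf{x}_{k-1}^TX(\lambda)=\mathbf{v}^TX(\lambda)^k,\qquad k\ge1,$$ converges to the vector $\mathbf{x}^T=(\ \mathbf{0}_{n_1\times1}^T\ |\ \mathbf{c}_2^T\ )$, where $\mathbf{c}_2\in\mathbb{R}^{n_2\times1}$ is the left-hand Perron vector of $P_{A_2}$.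
   Context: Vectors are column matrices. A vector or matrix is non-negative (positive) if all its entries are $\ge 0$ ($>0$). $\mathbf{e}=(1,\dots,1)^T$ and $\|\mathbf{x}\|_1=\sum_i|x_i|$. A personalization vector is a positive probability vector: $\mathbf{v}>0$ and $\mathbf{v}^T\mathbf{e}=1$. A square matrix $A$ of order $N\ge 2$ is reducible if there is a permutation matrix $R$ such that $R^TAR=\begin{pmatrix}X&Y\\ \mathbf{0}&Z\end{pmatrix}$ with $X,Z$ square (of order at least 1); otherwise it is irreducible. A $1\times1$ matrix is called irreducible when its entry is nonzero. Row-normalization: for a non-negative matrix $A=(a_{ij})$ with no zero row, $P_A=(p_{ij})$ is given by $p_{ij}=a_{ij}/\sum_k a_{ik}$; it is row-stochastic. Left-hand Perron vector: for a non-negative irreducible matrix $M$, the unique vector $\mathbf{q}$ with $\mathbf{q}^TM=\rho(M)\mathbf{q}^T$, $\mathbf{q}>0$, $\mathbf{q}^T\mathbf{e}=1$, where $\rho(M)$ is the spectral radius. *)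

theory Defs
  imports "Jordan_Normal_Form.Spectral_Radius" "Jordan_Normal_Form.Gauss_Jordan_Elimination"
begin

definition ones_vec :: "nat \<Rightarrow> real vec" where
  "ones_vec n = vec n (\<lambda>_. 1)"

definition vec_norm1 :: "real vec \<Rightarrow> real" where
  "vec_norm1 x = (\<Sum>i<dim_vec x. \<bar>x $ i\<bar>)"

(* The library order on vectors makes 0 < x mean "0 <= x and not x <= 0",
   which is weaker than strict positivity of every entry. *)
definition pos_vec :: "real vec \<Rightarrow> bool" where
  "pos_vec x \<longleftrightarrow> (\<forall>i<dim_vec x. 0 < x $ i)"

definition personalization_vec :: "nat \<Rightarrow> real vec \<Rightarrow> bool" where
  "personalization_vec n v \<longleftrightarrow> v \<in> carrier_vec n \<and> pos_vec v \<and> v \<bullet> ones_vec n = 1"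

definition permutation_matrix :: "nat \<Rightarrow> real mat \<Rightarrow> bool" where
  "permutation_matrix n R \<longleftrightarrow>
    (\<exists>p. p permutes {..<n} \<and> R = mat n n (\<lambda>(i, j). if i = p j then 1 else 0))"

definition reducible_matrix :: "real mat \<Rightarrow> bool" where
  "reducible_matrix A \<longleftrightarrow>
    square_mat A \<and> 2 \<le> dim_row A \<and>
    (\<exists>R X Y Z r s. 1 \<le> r \<and> 1 \<le> s \<and> r + s = dim_row A \<and>
       permutation_matrix (dim_row A) R \<and>
       X \<in> carrier_mat r r \<and> Y \<in> carrier_mat r s \<and> Z \<in> carrier_mat s s \<and>
       transpose_mat R * A * R = four_block_mat X Y (0\<^sub>m s r) Z)"

(* The notion of reducibility applies only to order at least 2, so order 1 needs its own convention. *)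
definition irreducible_matrix :: "real mat \<Rightarrow> bool" where
  "irreducible_matrix A \<longleftrightarrow>
    square_mat A \<and> 1 \<le> dim_row A \<and>
    (if dim_row A = 1 then A $$ (0, 0) \<noteq> 0 else \<not> reducible_matrix A)"

definition no_zero_row :: "real mat \<Rightarrow> bool" where
  "no_zero_row A \<longleftrightarrow> (\<forall>i<dim_row A. row A i \<noteq> 0\<^sub>v (dim_col A))"

(* Intended for non-negative matrices without zero rows; a zero row would be left zero,
   since x / 0 = 0. *)
definition row_normalize :: "real mat \<Rightarrow> real mat" where
  "row_normalize A =
    mat (dim_row A) (dim_col A) (\<lambda>(i, j). A $$ (i, j) / (\<Sum>k<dim_col A. A $$ (i, k)))"

(* mat_of_row q is the row matrix q^T. *)
definition is_left_perron_vec :: "real mat \<Rightarrow> real vec \<Rightarrow> bool" where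
  "is_left_perron_vec M q \<longleftrightarrow>
    q \<in> carrier_vec (dim_row M) \<and>
    mat_of_row q * M = spectral_radius (map_mat complex_of_real M) \<cdot>\<^sub>m mat_of_row q \<and>
    pos_vec q \<and> q \<bullet> ones_vec (dim_row M) = 1"

(* Meaningful for non-negative irreducible M, where the Perron-Frobenius theorem gives
   existence and uniqueness. *)
definition left_perron_vec :: "real mat \<Rightarrow> real vec" where
  "left_perron_vec M = (THE q. is_left_perron_vec M q)"

(* (1 - l) (I - l P)^(-1). For 0 < l < 1 and row-stochastic P the matrix I - l P is invertible,
   so mat_inverse does not return None. *)
definition X_matrix :: "real mat \<Rightarrow> real \<Rightarrow> real mat" where
  "X_matrix P l =
    (1 - l) \<cdot>\<^sub>m the (mat_inverse (1\<^sub>m (dim_row P) - l \<cdot>\<^sub>m P))"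

(* The type of vectors of arbitrary length carries no topology; this is convergence in R^n
   for n the length of the limit. *)
definition vec_tendsto :: "(nat \<Rightarrow> real vec) \<Rightarrow> real vec \<Rightarrow> bool" where
  "vec_tendsto x y \<longleftrightarrow>
    (\<forall>k. dim_vec (x k) = dim_vec y) \<and> (\<forall>i<dim_vec y. (\<lambda>k. x k $ i) \<longlonglongrightarrow> y $ i)"

end

theory Submission
  imports Defs
begin

text \<open>The resolvent \<open>X\<close> of a stochastic matrix \<open>P\<close> is again stochastic: applying a minimum
  principle to \<open>X = (1 - l) I + l P X\<close> gives \<open>X \<ge> 0\<close>. Its column \<open>j\<close> is strictly positive as soon
  as \<open>j\<close> belongs to every nonempty set of states closed under \<open>P\<close>, which irreducibility of the
  block \<open>A\<^sub>2\<close> guarantees for each \<open>j\<close> in the last block. One positive column makes \<open>X\<close> a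
  strict contraction in the 1-norm on vectors of total mass zero, so \<open>v\<^sup>T X\<^sup>k\<close> converges to
  any fixed probability vector of \<open>X\<close>. The Perron vector of the normalized block, padded with
  zeros, is fixed by \<open>P\<close> and hence by \<open>X\<close>.\<close>

section \<open>Closed sets of states\<close>

definition row_stochastic :: "nat \<Rightarrow> real mat \<Rightarrow> bool" where
  "row_stochastic n P \<longleftrightarrow> P \<in> carrier_mat n n \<and> (\<forall>i<n. \<forall>j<n. 0 \<le> P $$ (i, j)) \<and>
    (\<forall>i<n. (\<Sum>j<n. P $$ (i, j)) = 1)"

text \<open>Invariant sets of the digraph of nonzero entries take the place of directed paths here.
  The empty set counts as closed, so each use also asks for \<open>S \<noteq> {}\<close>.\<close>

definition closed_states :: "real mat \<Rightarrow> nat set \<Rightarrow> bool" where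
  "closed_states A S \<longleftrightarrow> S \<subseteq> {..<dim_row A} \<and>
    (\<forall>i\<in>S. \<forall>j<dim_row A. A $$ (i, j) \<noteq> 0 \<longrightarrow> j \<in> S)"

lemma row_stochasticD:
  assumes "row_stochastic n P"
  shows "P \<in> carrier_mat n n" "dim_row P = n" "dim_col P = n"
    and "\<And>i j. i < n \<Longrightarrow> j < n \<Longrightarrow> 0 \<le> P $$ (i, j)"
    and "\<And>i. i < n \<Longrightarrow> (\<Sum>j<n. P $$ (i, j)) = 1"
  using assms unfolding row_stochastic_def by auto

text \<open>Two bijections between sets of equal size are glued into a relabelling that lists the
  complement of \<open>S\<close> first and \<open>S\<close> last, the order in which a closed set
  shows up as a zero block at the lower left.\<close>

lemma permutation_separating_set:
  assumes "S \<subseteq> {..<n::nat}"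
  shows "\<exists>p. p permutes {..<n} \<and> (\<forall>j<n. p j \<in> S \<longleftrightarrow> n - card S \<le> j)"
proof -
  have fS: "finite S" using assms finite_subset by blast
  have cS: "card S \<le> n" using card_mono[OF _ assms] by simp
  let ?r = "n - card S"
  have "card ({..<n} - S) = card {..<?r}"
    using card_Diff_subset[OF fS assms] by simp
  then obtain f where f: "bij_betw f {..<?r} ({..<n} - S)"
    using bij_betw_iff_card[of "{..<?r}" "{..<n} - S"] by auto
  have "card S = card {?r..<n}" using cS by simp
  then obtain g where g: "bij_betw g {?r..<n} S"
    using bij_betw_iff_card[of "{?r..<n}" S] fS by auto
  \<comment> \<open>The last branch is the identity because \<open>permutes\<close> fixes everything
    outside \<open>{..<n}\<close>.\<close>
  define p where "p j = (if j < ?r then f j else if j < n then g j else j)" for j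
  have "bij_betw p {..<?r} ({..<n} - S)"
    using f by (rule bij_betw_cong[THEN iffD1, rotated]) (simp add: p_def)
  moreover have "bij_betw p {?r..<n} S"
    using g by (rule bij_betw_cong[THEN iffD1, rotated]) (simp add: p_def)
  ultimately have "bij_betw p ({..<?r} \<union> {?r..<n}) (({..<n} - S) \<union> S)"
    by (rule bij_betw_combine) auto
  moreover have "{..<?r} \<union> {?r..<n} = {..<n}" using cS by auto
  moreover have "({..<n} - S) \<union> S = {..<n}" using assms by auto
  ultimately have "bij_betw p {..<n} {..<n}" by simp
  then have perm: "p permutes {..<n}"
    by (rule bij_imp_permutes) (auto simp: p_def)
  have "p j \<in> S \<longleftrightarrow> ?r \<le> j" if "j < n" for j
  proof (cases "j < ?r")
    case True
    then have "f j \<in> {..<n} - S" using f by (auto simp: bij_betw_def)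
    then show ?thesis using True by (auto simp: p_def)
  next
    case False
    then have "g j \<in> S" using g that by (auto simp: bij_betw_def)
    then show ?thesis using False that by (auto simp: p_def)
  qed
  with perm show ?thesis by blast
qed

lemma conj_permutation_matrix_index:
  fixes A :: "real mat"
  assumes A: "A \<in> carrier_mat n n" and p: "p permutes {..<n}"
    and R: "R = mat n n (\<lambda>(i, j). if i = p j then 1 else 0)"
    and i: "i < n" and j: "j < n"
  shows "(transpose_mat R * A * R) $$ (i, j) = A $$ (p i, p j)"
proof -
  have pn: "p k < n" if "k < n" for k using permutes_in_image[OF p, of k] that by simp
  have 1: "(transpose_mat R * A) $$ (i, k) = A $$ (p i, k)" if "k < n" for k
  proof -
    have "(transpose_mat R * A) $$ (i, k) = (\<Sum>m\<in>{0..<n}. (if m = p i then 1 else 0) * A $$ (m, k))"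
      using A i that by (simp add: R scalar_prod_def)
    also have "\<dots> = (\<Sum>m\<in>{0..<n}. if m = p i then A $$ (m, k) else 0)"
      by (rule sum.cong) auto
    also have "\<dots> = A $$ (p i, k)" using pn[OF i] by (simp add: sum.delta)
    finally show ?thesis .
  qed
  have "(transpose_mat R * A * R) $$ (i, j) =
      (\<Sum>k\<in>{0..<n}. (transpose_mat R * A) $$ (i, k) * (if k = p j then 1 else 0))"
    using A i j by (simp add: R scalar_prod_def)
  also have "\<dots> = (\<Sum>k\<in>{0..<n}. if k = p j then A $$ (p i, k) else 0)"
    by (rule sum.cong) (auto simp: 1)
  also have "\<dots> = A $$ (p i, p j)" using pn[OF j] by (simp add: sum.delta)
  finally show ?thesis .
qed

text \<open>A proper nonempty closed set, listed last, would bring the matrix into reducible form.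
  Such a set can exist only if \<open>2 \<le> n\<close>, so the separate convention for order 1 does
  not interfere.\<close>

lemma irreducible_closed_states:
  assumes irr: "irreducible_matrix A" and S: "closed_states A S" and ne: "S \<noteq> {}"
  shows "S = {..<dim_row A}"
proof (rule ccontr)
  define n where "n = dim_row A"
  assume "S \<noteq> {..<dim_row A}"
  then have ps: "S \<subset> {..<n}" using S by (auto simp: closed_states_def n_def)
  have fS: "finite S" using ps finite_subset by blast
  define s where "s = card S"
  have s1: "1 \<le> s" using ne fS unfolding s_def by (simp add: card_gt_0_iff Suc_leI)
  have sn: "s < n" unfolding s_def using psubset_card_mono[OF _ ps] by simp
  have A: "A \<in> carrier_mat n n" using irr by (auto simp: irreducible_matrix_def n_def)
  obtain p where p: "p permutes {..<n}" and pS: "\<And>j. j < n \<Longrightarrow> p j \<in> S \<longleftrightarrow> n - s \<le> j"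
    using permutation_separating_set[of S n] ps unfolding s_def by auto
  define R :: "real mat" where "R = mat n n (\<lambda>(i, j). if i = p j then 1 else 0)"
  let ?C = "transpose_mat R * A * R"
  have pn: "p k < n" if "k < n" for k using permutes_in_image[OF p, of k] that by simp
  let ?r = "n - s"
  define X Y Z where "X = mat ?r ?r (\<lambda>(i, j). ?C $$ (i, j))"
    and "Y = mat ?r s (\<lambda>(i, j). ?C $$ (i, j + ?r))"
    and "Z = mat s s (\<lambda>(i, j). ?C $$ (i + ?r, j + ?r))"
  have XYZ: "X \<in> carrier_mat ?r ?r" "Y \<in> carrier_mat ?r s" "Z \<in> carrier_mat s s"
    by (simp_all add: X_def Y_def Z_def)
  have eq: "?C = four_block_mat X Y (0\<^sub>m s ?r) Z" (is "_ = ?D")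
  proof (rule eq_matI)
    fix i j assume "i < dim_row ?D" "j < dim_col ?D"
    then have i: "i < n" and j: "j < n" using sn XYZ by auto
    \<comment> \<open>Row \<open>i\<close> now belongs to a state in \<open>S\<close> and column
      \<open>j\<close> to one outside, so a nonzero entry would leave \<open>S\<close>.\<close>
    have "?C $$ (i, j) = 0" if "?r \<le> i" "j < ?r"
    proof -
      have "p i \<in> S" "p j \<notin> S" using pS[OF i] pS[OF j] that by auto
      then have "A $$ (p i, p j) = 0"
        using S pn[OF j] by (auto simp: closed_states_def n_def)
      then show ?thesis using conj_permutation_matrix_index[OF A p R_def i j] by simp
    qed
    then show "?C $$ (i, j) = ?D $$ (i, j)" using i j sn by (auto simp: X_def Y_def Z_def)
  qed (use A sn XYZ in \<open>auto simp: R_def\<close>)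
  have perm: "permutation_matrix n R" using p unfolding permutation_matrix_def R_def by blast
  have bounds: "1 \<le> ?r" "?r + s = n" "2 \<le> n" using sn s1 by auto
  have "square_mat A" using A by simp
  then have "reducible_matrix A"
    unfolding reducible_matrix_def n_def[symmetric]
    using bounds s1 perm XYZ eq by blast
  then show False using irr \<open>2 \<le> n\<close> by (auto simp: irreducible_matrix_def n_def)
qed

section \<open>The resolvent of a stochastic matrix\<close>

text \<open>At a state where \<open>w\<close> takes its minimum \<open>m\<close>, the average of
  \<open>w\<close> along that row is at least \<open>m\<close>. Hence \<open>l * m \<le> m\<close>,
  and \<open>l < 1\<close> forces \<open>0 \<le> m\<close>. Applied to both \<open>w\<close> and
  \<open>- w\<close>, this shows that \<open>w = l P w\<close> has only the zero solution.\<close>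

lemma minimum_principle:
  assumes P: "row_stochastic n P" and l: "0 < l" "l < 1"
    and super: "\<And>i. i < n \<Longrightarrow> l * (\<Sum>j<n. P $$ (i, j) * w j) \<le> w i"
    and i: "i < n"
  shows "0 \<le> w i"
proof -
  note P' = row_stochasticD[OF P]
  define m where "m = Min (w ` {..<n})"
  have mle: "m \<le> w j" if "j < n" for j using that by (simp add: m_def)
  have "m \<in> w ` {..<n}" unfolding m_def using i by (intro Min_in) auto
  then obtain k where k: "k < n" "w k = m" by auto
  have "m = (\<Sum>j<n. P $$ (k, j) * m)" using P'(5)[OF k(1)] by (simp flip: sum_distrib_right)
  also have "\<dots> \<le> (\<Sum>j<n. P $$ (k, j) * w j)"
    by (intro sum_mono mult_left_mono mle P'(4) k) auto
  finally have "l * m \<le> m" using super[OF k(1)] k(2) l(1)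
    by (meson mult_left_mono less_imp_le order_trans)
  then have "0 \<le> (1 - l) * m" by (simp add: algebra_simps)
  then have "0 \<le> m" using l(2) by (simp add: zero_le_mult_iff)
  then show ?thesis using mle[OF i] by simp
qed

text \<open>A kernel vector satisfies \<open>w = l P w\<close>, so the minimum principle for
  \<open>w\<close> and \<open>- w\<close> makes it zero. The determinant is therefore nonzero and
  \<open>mat_inverse\<close> does not return \<open>None\<close>.\<close>

lemma resolvent_inverse:
  assumes P: "row_stochastic n P" and l: "0 < l" "l < 1"
  obtains Y where "mat_inverse (1\<^sub>m n - l \<cdot>\<^sub>m P) = Some Y" "Y \<in> carrier_mat n n"
    "(1\<^sub>m n - l \<cdot>\<^sub>m P) * Y = 1\<^sub>m n"
proof -
  note P' = row_stochasticD[OF P]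
  let ?M = "1\<^sub>m n - l \<cdot>\<^sub>m P"
  have M: "?M \<in> carrier_mat n n" using P'(1) by auto
  have "det ?M \<noteq> 0"
  proof
    assume "det ?M = 0"
    then obtain w where w: "w \<in> carrier_vec n" "w \<noteq> 0\<^sub>v n" "?M *\<^sub>v w = 0\<^sub>v n"
      using det_0_iff_vec_prod_zero[OF M] by auto
    have eq: "w $ i = l * (\<Sum>j<n. P $$ (i, j) * w $ j)" if i: "i < n" for i
    proof -
      have "?M *\<^sub>v w = w - l \<cdot>\<^sub>v (P *\<^sub>v w)"
        using P'(1) w(1) by (intro eq_vecI) (simp_all add: minus_mult_distrib_mat_vec[of _ n n])
      then have "(w - l \<cdot>\<^sub>v (P *\<^sub>v w)) $ i = 0" using w(3) i by (metis index_zero_vec(1))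
      then show ?thesis using i P'(2,3) w(1)
        by (simp add: scalar_prod_def atLeast0LessThan)
    qed
    have "0 \<le> w $ i" if "i < n" for i
      by (rule minimum_principle[OF P l _ that]) (simp flip: eq)
    moreover have "0 \<le> - w $ i" if "i < n" for i
      by (rule minimum_principle[OF P l _ that]) (simp add: sum_negf flip: eq)
    ultimately have "w = 0\<^sub>v n" using w(1) by (intro eq_vecI) (auto intro: antisym)
    with w(2) show False by simp
  qed
  then have "?M \<in> Units (ring_mat TYPE(real) n ())" by (rule det_non_zero_imp_unit[OF M])
  then have "mat_inverse ?M \<noteq> None" using mat_inverse(1)[OF M, of "()"] by blast
  then obtain Y where "mat_inverse ?M = Some Y" by blast
  with mat_inverse(2)[OF M this] show thesis using that by blast
qed

text \<open>The second equation is \<open>(I - l P) X = (1 - l) I\<close> rearranged. Everything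
  proved later about \<open>X_matrix\<close> rests on this recurrence and not on the
  inverse.\<close>

lemma X_matrix_equations:
  assumes P: "row_stochastic n P" and l: "0 < l" "l < 1"
  defines "X \<equiv> X_matrix P l"
  shows "X \<in> carrier_mat n n"
    and "X = (1 - l) \<cdot>\<^sub>m 1\<^sub>m n + l \<cdot>\<^sub>m (P * X)"
proof -
  note P' = row_stochasticD[OF P]
  obtain Y where Y: "mat_inverse (1\<^sub>m n - l \<cdot>\<^sub>m P) = Some Y" "Y \<in> carrier_mat n n"
    "(1\<^sub>m n - l \<cdot>\<^sub>m P) * Y = 1\<^sub>m n"
    using resolvent_inverse[OF P l] .
  have X: "X = (1 - l) \<cdot>\<^sub>m Y" unfolding X_def X_matrix_def using Y(1) P'(2) by simp
  show Xc: "X \<in> carrier_mat n n" using X Y(2) by simp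
  have M: "1\<^sub>m n - l \<cdot>\<^sub>m P \<in> carrier_mat n n" using P'(1) by auto
  have MX: "(1\<^sub>m n - l \<cdot>\<^sub>m P) * X = (1 - l) \<cdot>\<^sub>m 1\<^sub>m n"
    unfolding X using Y(3) mult_smult_distrib[OF M Y(2)] by simp
  have "X - l \<cdot>\<^sub>m (P * X) = (1 - l) \<cdot>\<^sub>m 1\<^sub>m n"
    using MX Xc P'(1) minus_mult_distrib_mat[of "1\<^sub>m n" n n "l \<cdot>\<^sub>m P" X n]
      mult_smult_assoc_mat[OF P'(1) Xc, of l] by simp
  then have "X $$ (i, j) - l * (P * X) $$ (i, j) = (1 - l) * 1\<^sub>m n $$ (i, j)"
    if "i < n" "j < n" for i j
    using that Xc P'(1) by (metis carrier_matD index_minus_mat(1) index_mult_mat(2,3)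
      index_one_mat(2,3) index_smult_mat(1-3))
  then show "X = (1 - l) \<cdot>\<^sub>m 1\<^sub>m n + l \<cdot>\<^sub>m (P * X)"
    using Xc P'(1) by (intro eq_matI) (auto simp: algebra_simps)
qed

lemma X_matrix_entry:
  assumes P: "row_stochastic n P" and l: "0 < l" "l < 1" and i: "i < n" and j: "j < n"
  shows "X_matrix P l $$ (i, j) =
    (1 - l) * (if i = j then 1 else 0) + l * (\<Sum>k<n. P $$ (i, k) * X_matrix P l $$ (k, j))"
proof -
  note P' = row_stochasticD[OF P] and X = X_matrix_equations[OF P l]
  have "X_matrix P l $$ (i, j) = ((1 - l) \<cdot>\<^sub>m 1\<^sub>m n + l \<cdot>\<^sub>m (P * X_matrix P l)) $$ (i, j)"
    using X(2) by simp
  then show ?thesis using i j P'(1) X(1) by (simp add: scalar_prod_def atLeast0LessThan)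
qed

text \<open>Dropping the non-negative term \<open>(1 - l) I\<close> from the recurrence makes each
  column satisfy the hypothesis of the minimum principle. The defect \<open>d\<close> of the row
  sums from 1 solves \<open>d = l P d\<close> and hence vanishes.\<close>

lemma X_matrix_stochastic:
  assumes P: "row_stochastic n P" and l: "0 < l" "l < 1"
  shows "row_stochastic n (X_matrix P l)"
  unfolding row_stochastic_def
proof (intro conjI allI impI)
  note P' = row_stochasticD[OF P] and X = X_matrix_equations[OF P l]
    and entry = X_matrix_entry[OF P l]
  let ?X = "X_matrix P l"
  show "?X \<in> carrier_mat n n" by (rule X)
  show "0 \<le> ?X $$ (i, j)" if "i < n" "j < n" for i j
  proof (rule minimum_principle[OF P l _ \<open>i < n\<close>, where w="\<lambda>i. ?X $$ (i, j)"])
    fix i assume "i < n"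
    show "l * (\<Sum>k<n. P $$ (i, k) * ?X $$ (k, j)) \<le> ?X $$ (i, j)"
      by (subst entry[OF \<open>i < n\<close> \<open>j < n\<close>]) (use l in simp)
  qed
  define d where "d i = (\<Sum>j<n. ?X $$ (i, j)) - 1" for i
  have d: "d i = l * (\<Sum>k<n. P $$ (i, k) * d k)" if i: "i < n" for i
  proof -
    have "(\<Sum>j<n. ?X $$ (i, j)) = (\<Sum>j<n. (1 - l) * (if i = j then 1 else 0) +
        l * (\<Sum>k<n. P $$ (i, k) * ?X $$ (k, j)))"
      by (intro sum.cong entry i) auto
    also have "\<dots> = (1 - l) + l * (\<Sum>j<n. \<Sum>k<n. P $$ (i, k) * ?X $$ (k, j))"
      using i by (simp add: sum.distrib flip: sum_distrib_left)
    also have "(\<Sum>j<n. \<Sum>k<n. P $$ (i, k) * ?X $$ (k, j)) =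
        (\<Sum>k<n. P $$ (i, k) * (\<Sum>j<n. ?X $$ (k, j)))"
      by (subst sum.swap) (simp add: sum_distrib_left)
    also have "\<dots> = (\<Sum>k<n. P $$ (i, k) * d k) + 1"
      using P'(5)[OF i] by (simp add: d_def right_diff_distrib sum_subtractf)
    finally show ?thesis by (simp add: d_def algebra_simps)
  qed
  have "0 \<le> d i" if "i < n" for i
    by (rule minimum_principle[OF P l _ that]) (simp flip: d)
  moreover have "0 \<le> - d i" if "i < n" for i
    by (rule minimum_principle[OF P l _ that]) (simp add: sum_negf flip: d)
  ultimately show "(\<Sum>j<n. ?X $$ (i, j)) = 1" if "i < n" for i
    using that by (force simp: d_def)
qed

text \<open>The zero set of column \<open>j\<close> is closed under \<open>P\<close>. If it were
  nonempty it would contain \<open>j\<close>, but the diagonal entry at \<open>j\<close> is at least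
  \<open>1 - l\<close>.\<close>

lemma X_matrix_column_pos:
  assumes P: "row_stochastic n P" and l: "0 < l" "l < 1" and j: "j < n"
    and access: "\<And>S. closed_states P S \<Longrightarrow> S \<noteq> {} \<Longrightarrow> j \<in> S" and i: "i < n"
  shows "0 < X_matrix P l $$ (i, j)"
proof (rule ccontr)
  note P' = row_stochasticD[OF P] and entry = X_matrix_entry[OF P l]
    and X' = row_stochasticD[OF X_matrix_stochastic[OF P l]]
  let ?X = "X_matrix P l"
  assume "\<not> 0 < ?X $$ (i, j)"
  define S where "S = {i. i < n \<and> ?X $$ (i, j) = 0}"
  have term0: "0 \<le> P $$ (i, k) * ?X $$ (k, j)" if "i < n" "k < n" for i k
    using P'(4) X'(4) that j by simp
  have "i \<in> S" using \<open>\<not> 0 < ?X $$ (i, j)\<close> X'(4)[OF i j] i by (auto simp: S_def)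
  moreover have "closed_states P S"
    unfolding closed_states_def
  proof (intro conjI ballI allI impI)
    show "S \<subseteq> {..<dim_row P}" using P'(2) by (auto simp: S_def)
    fix i k assume "i \<in> S" and k: "k < dim_row P" and nz: "P $$ (i, k) \<noteq> 0"
    then have i: "i < n" "?X $$ (i, j) = 0" by (auto simp: S_def)
    have k: "k < n" using k P'(2) by simp
    have ge: "0 \<le> (\<Sum>k<n. P $$ (i, k) * ?X $$ (k, j))"
      by (rule sum_nonneg) (use term0 i in auto)
    \<comment> \<open>The recurrence writes the vanishing entry as a non-negative multiple of
      \<open>1 - l\<close> plus this term, so a sum of non-negative products has to vanish
      termwise.\<close>
    have "l * (\<Sum>k<n. P $$ (i, k) * ?X $$ (k, j)) \<le> 0"
      using entry[OF i(1) j] i(2) l by (auto split: if_splits)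
    then have "(\<Sum>k<n. P $$ (i, k) * ?X $$ (k, j)) = 0"
      using ge l(1) by (simp add: mult_le_0_iff)
    then have "P $$ (i, k) * ?X $$ (k, j) = 0"
      using sum_nonneg_eq_0_iff[of "{..<n}" "\<lambda>k. P $$ (i, k) * ?X $$ (k, j)"] term0 i(1) k by auto
    then show "k \<in> S" using nz k by (simp add: S_def)
  qed
  ultimately have "j \<in> S" using access by blast
  moreover have "0 < ?X $$ (j, j)"
  proof -
    have "0 \<le> (\<Sum>k<n. P $$ (j, k) * ?X $$ (k, j))" by (rule sum_nonneg) (use term0 j in auto)
    then show ?thesis using entry[OF j j] l by (simp add: add_pos_nonneg)
  qed
  ultimately show False by (simp add: S_def)
qed

section \<open>Convergence to the stationary distribution\<close>

text \<open>Doeblin's argument: on vectors of total mass zero the entries of column \<open>j\<close> may be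
  lowered by their common lower bound \<open>e\<close> without changing the product.\<close>
lemma doeblin_contraction:
  assumes Q: "row_stochastic n Q" and j: "j < n" and e: "\<And>i. i < n \<Longrightarrow> e \<le> Q $$ (i, j)"
    and z: "(\<Sum>i<n. z i) = 0"
  shows "(\<Sum>k<n. \<bar>\<Sum>i<n. z i * Q $$ (i, k)\<bar>) \<le> (1 - e) * (\<Sum>i<n. \<bar>z i\<bar>)"
proof -
  note Q' = row_stochasticD[OF Q]
  define T where "T i k = Q $$ (i, k) - (if k = j then e else 0)" for i k
  have T: "0 \<le> T i k" if "i < n" "k < n" for i k using that e Q'(4) by (auto simp: T_def)
  have zT: "(\<Sum>i<n. z i * Q $$ (i, k)) = (\<Sum>i<n. z i * T i k)" for k
    using z by (simp add: T_def right_diff_distrib sum_subtractf flip: sum_distrib_right)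
  have "(\<Sum>k<n. \<bar>\<Sum>i<n. z i * Q $$ (i, k)\<bar>) \<le> (\<Sum>k<n. \<Sum>i<n. \<bar>z i\<bar> * T i k)"
  proof (rule sum_mono)
    fix k assume "k \<in> {..<n}"
    then have "(\<Sum>i<n. \<bar>z i * T i k\<bar>) = (\<Sum>i<n. \<bar>z i\<bar> * T i k)"
      using T by (intro sum.cong) (auto simp: abs_mult)
    then show "\<bar>\<Sum>i<n. z i * Q $$ (i, k)\<bar> \<le> (\<Sum>i<n. \<bar>z i\<bar> * T i k)"
      unfolding zT by (metis sum_abs)
  qed
  also have "\<dots> = (\<Sum>i<n. \<bar>z i\<bar> * (\<Sum>k<n. T i k))"
    by (subst sum.swap) (simp add: sum_distrib_left)
  \<comment> \<open>Each row of \<open>T\<close> is a row of \<open>Q\<close> with \<open>e\<close>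
    removed once, in column \<open>j\<close>.\<close>
  also have "\<dots> = (\<Sum>i<n. \<bar>z i\<bar> * (1 - e))"
    using Q'(5) j by (intro sum.cong) (auto simp: T_def sum_subtractf)
  finally show ?thesis by (simp add: mult.commute flip: sum_distrib_right)
qed

text \<open>Rows of \<open>Q\<close> sum to 1, so the difference between \<open>y k\<close> and
  \<open>c\<close> keeps total mass zero. The contraction then applies at every step, and the 1-norm
  of the difference decays like \<open>(1 - e) ^ k\<close>.\<close>

lemma doeblin_convergence:
  assumes Q: "row_stochastic n Q" and j: "j < n" and pos: "\<And>i. i < n \<Longrightarrow> 0 < Q $$ (i, j)"
    and y: "\<And>k m. m < n \<Longrightarrow> y (Suc k) m = (\<Sum>i<n. y k i * Q $$ (i, m))"
    and c: "\<And>m. m < n \<Longrightarrow> c m = (\<Sum>i<n. c i * Q $$ (i, m))"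
    and mass: "(\<Sum>i<n. y 0 i) = (\<Sum>i<n. c i)" and m: "m < n"
  shows "(\<lambda>k. y k m) \<longlonglongrightarrow> c m"
proof -
  note Q' = row_stochasticD[OF Q]
  \<comment> \<open>A minimum of finitely many positive entries is positive, and as an entry of a
    stochastic row it is at most 1. So the ratio \<open>1 - e\<close> lies in [0, 1).\<close>
  define e where "e = Min ((\<lambda>i. Q $$ (i, j)) ` {..<n})"
  have e: "e \<le> Q $$ (i, j)" if "i < n" for i using that by (simp add: e_def)
  have "e \<in> (\<lambda>i. Q $$ (i, j)) ` {..<n}" unfolding e_def using j by (intro Min_in) auto
  then obtain i0 where i0: "i0 < n" "e = Q $$ (i0, j)" by auto
  have e0: "0 < e" using pos i0 by simp
  have "Q $$ (i0, j) \<le> (\<Sum>k<n. Q $$ (i0, k))"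
    by (rule member_le_sum) (use Q'(4) i0 j in auto)
  then have e1: "e \<le> 1" using Q'(5) i0 by simp
  define z where "z k i = y k i - c i" for k i
  have zS: "z (Suc k) m = (\<Sum>i<n. z k i * Q $$ (i, m))" if "m < n" for k m
    using y[OF that, of k] c[OF that] by (simp add: z_def left_diff_distrib sum_subtractf)
  have sumz: "(\<Sum>i<n. z k i) = 0" for k
  proof (induction k)
    case 0
    then show ?case using mass by (simp add: z_def sum_subtractf)
  next
    case (Suc k)
    have "(\<Sum>m<n. z (Suc k) m) = (\<Sum>m<n. \<Sum>i<n. z k i * Q $$ (i, m))" by (simp add: zS)
    also have "\<dots> = (\<Sum>i<n. z k i * (\<Sum>m<n. Q $$ (i, m)))"
      by (subst sum.swap) (simp add: sum_distrib_left)
    also have "\<dots> = 0" using Q'(5) Suc by simp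
    finally show ?case .
  qed
  have bound: "(\<Sum>i<n. \<bar>z k i\<bar>) \<le> (1 - e) ^ k * (\<Sum>i<n. \<bar>z 0 i\<bar>)" for k
  proof (induction k)
    case (Suc k)
    have "(\<Sum>i<n. \<bar>z (Suc k) i\<bar>) \<le> (1 - e) * (\<Sum>i<n. \<bar>z k i\<bar>)"
      using doeblin_contraction[OF Q j e sumz] by (simp add: zS)
    also have "\<dots> \<le> (1 - e) * ((1 - e) ^ k * (\<Sum>i<n. \<bar>z 0 i\<bar>))"
      using Suc e1 by (intro mult_left_mono) auto
    finally show ?case by (simp add: mult.assoc)
  qed simp
  have "norm (z k m) \<le> (1 - e) ^ k * (\<Sum>i<n. \<bar>z 0 i\<bar>)" for k
  proof -
    have "\<bar>z k m\<bar> \<le> (\<Sum>i<n. \<bar>z k i\<bar>)" by (rule member_le_sum) (use m in auto)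
    then show ?thesis using bound[of k] by simp
  qed
  moreover have "(\<lambda>k. (1 - e) ^ k * (\<Sum>i<n. \<bar>z 0 i\<bar>)) \<longlonglongrightarrow> 0"
    using e0 e1 by (intro tendsto_mult_left_zero LIMSEQ_power_zero) auto
  ultimately have "(\<lambda>k. \<bar>z k m\<bar>) \<longlonglongrightarrow> 0"
    using tendsto_sandwich[of "\<lambda>_. 0" "\<lambda>k. \<bar>z k m\<bar>" sequentially
      "\<lambda>k. (1 - e) ^ k * (\<Sum>i<n. \<bar>z 0 i\<bar>)" 0] by simp
  then have "(\<lambda>k. z k m) \<longlonglongrightarrow> 0" by (rule tendsto_rabs_zero_cancel)
  then show ?thesis by (simp add: z_def LIM_zero_iff)
qed

section \<open>The stationary distribution as left Perron vector\<close>

text \<open>The left eigenvector equation for eigenvalue 1. Functions instead of vectors let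
  absolute values, positive parts and differences be formed pointwise without length
  conditions.\<close>

definition left_fixed :: "nat \<Rightarrow> real mat \<Rightarrow> (nat \<Rightarrow> real) \<Rightarrow> bool" where
  "left_fixed n P w \<longleftrightarrow> (\<forall>j<n. (\<Sum>i<n. w i * P $$ (i, j)) = w j)"

lemma mat_of_row_mult_eq_iff:
  fixes M :: "real mat"
  assumes "M \<in> carrier_mat n m" "q \<in> carrier_vec n" "y \<in> carrier_vec m"
  shows "mat_of_row q * M = mat_of_row y \<longleftrightarrow> (\<forall>j<m. (\<Sum>i<n. q $ i * M $$ (i, j)) = y $ j)"
proof -
  have index: "(mat_of_row q * M) $$ (0, j) = (\<Sum>i<n. q $ i * M $$ (i, j))" if "j < m" for j
    using that assms by (simp add: scalar_prod_def atLeast0LessThan)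
  show ?thesis
  proof
    assume "mat_of_row q * M = mat_of_row y"
    then have "(mat_of_row q * M) $$ (0, j) = y $ j" if "j < m" for j
      using that assms by simp
    then show "\<forall>j<m. (\<Sum>i<n. q $ i * M $$ (i, j)) = y $ j" using index by simp
  next
    assume *: "\<forall>j<m. (\<Sum>i<n. q $ i * M $$ (i, j)) = y $ j"
    show "mat_of_row q * M = mat_of_row y"
    proof (rule eq_matI)
      fix i j assume "i < dim_row (mat_of_row y)" "j < dim_col (mat_of_row y)"
      then have "i = 0" "j < m" using assms by auto
      then show "(mat_of_row q * M) $$ (i, j) = mat_of_row y $$ (i, j)"
        using index * assms by simp
    qed (use assms in auto)
  qed
qed

lemma eigenvalue_one_stochastic:
  assumes P: "row_stochastic n P" and n: "0 < n"
  shows "eigenvalue P 1"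
proof -
  note P' = row_stochasticD[OF P]
  have "P *\<^sub>v ones_vec n = ones_vec n"
    using P' by (intro eq_vecI) (auto simp: ones_vec_def scalar_prod_def atLeast0LessThan)
  moreover have "ones_vec n $ 0 \<noteq> (0\<^sub>v n :: real vec) $ 0" using n by (simp add: ones_vec_def)
  then have "ones_vec n \<noteq> 0\<^sub>v n" by metis
  ultimately have "eigenvector P (ones_vec n) 1"
    using P'(2) by (simp add: eigenvector_def) (simp add: ones_vec_def)
  then show ?thesis unfolding eigenvalue_def by blast
qed

text \<open>A matrix and its transpose share their characteristic polynomial, so the eigenvalue 1 of
  the all-ones vector also has a left eigenvector. Its signs are still unknown.\<close>

lemma exists_left_fixed:
  assumes P: "row_stochastic n P" and n: "0 < n"
  obtains w where "left_fixed n P w" "\<exists>i<n. w i \<noteq> 0"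
proof -
  note P' = row_stochasticD[OF P]
  have PT: "transpose_mat P \<in> carrier_mat n n" using P'(1) by simp
  have "eigenvalue (transpose_mat P) 1"
    using eigenvalue_one_stochastic[OF P n] P'(1)
    unfolding eigenvalue_root_char_poly[OF P'(1)] eigenvalue_root_char_poly[OF PT] by simp
  then obtain w where w: "w \<in> carrier_vec n" "w \<noteq> 0\<^sub>v n" "transpose_mat P *\<^sub>v w = w"
    using P'(3) by (auto simp: eigenvalue_def eigenvector_def)
  have "(\<Sum>i<n. w $ i * P $$ (i, j)) = w $ j" if "j < n" for j
  proof -
    have "(transpose_mat P *\<^sub>v w) $ j = (\<Sum>i<n. P $$ (i, j) * w $ i)"
      using that P' w(1) by (simp add: scalar_prod_def atLeast0LessThan)
    then show ?thesis using w(3) by (simp add: mult.commute)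
  qed
  moreover have "\<exists>i<n. w $ i \<noteq> 0" using w(1,2) by (metis carrier_vecD eq_vecI index_zero_vec)
  ultimately show thesis using that[of "\<lambda>i. w $ i"] by (simp add: left_fixed_def)
qed

text \<open>The triangle inequality makes every defect \<open>g j\<close> non-negative. Since rows
  sum to 1, multiplying by \<open>P\<close> preserves the total mass of the absolute values, so the
  defects sum to zero and each vanishes.\<close>

lemma left_fixed_abs:
  assumes P: "row_stochastic n P" and w: "left_fixed n P w"
  shows "left_fixed n P (\<lambda>i. \<bar>w i\<bar>)"
  unfolding left_fixed_def
proof (intro allI impI)
  note P' = row_stochasticD[OF P]
  define g where "g j = (\<Sum>i<n. \<bar>w i\<bar> * P $$ (i, j)) - \<bar>w j\<bar>" for j
  have g0: "0 \<le> g j" if j: "j < n" for j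
  proof -
    have "\<bar>w j\<bar> = \<bar>\<Sum>i<n. w i * P $$ (i, j)\<bar>" using w j by (simp add: left_fixed_def)
    also have "\<dots> \<le> (\<Sum>i<n. \<bar>w i * P $$ (i, j)\<bar>)" by (rule sum_abs)
    also have "\<dots> = (\<Sum>i<n. \<bar>w i\<bar> * P $$ (i, j))"
      using P'(4) j by (intro sum.cong) (auto simp: abs_mult)
    finally show ?thesis by (simp add: g_def)
  qed
  have "(\<Sum>j<n. g j) = (\<Sum>j<n. \<Sum>i<n. \<bar>w i\<bar> * P $$ (i, j)) - (\<Sum>j<n. \<bar>w j\<bar>)"
    by (simp add: g_def sum_subtractf)
  also have "(\<Sum>j<n. \<Sum>i<n. \<bar>w i\<bar> * P $$ (i, j)) = (\<Sum>i<n. \<bar>w i\<bar> * (\<Sum>j<n. P $$ (i, j)))"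
    by (subst sum.swap) (simp add: sum_distrib_left)
  finally have "(\<Sum>j<n. g j) = 0" using P'(5) by simp
  then have "g j = 0" if "j < n" for j
    using sum_nonneg_eq_0_iff[of "{..<n}" g] g0 that by auto
  then show "(\<Sum>i<n. \<bar>w i\<bar> * P $$ (i, j)) = \<bar>w j\<bar>" if "j < n" for j
    using that by (simp add: g_def)
qed

text \<open>The support of a non-negative fixed vector is closed, because positive mass at a state
  is passed on along every nonzero entry of its row.\<close>

lemma left_fixed_nonneg_pos:
  assumes P: "row_stochastic n P"
    and irr: "\<And>S. closed_states P S \<Longrightarrow> S \<noteq> {} \<Longrightarrow> S = {..<n}"
    and w: "left_fixed n P w" and nn: "\<And>i. i < n \<Longrightarrow> 0 \<le> w i"
    and i: "i < n" "w i \<noteq> 0" and j: "j < n"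
  shows "0 < w j"
proof -
  note P' = row_stochasticD[OF P]
  define S where "S = {i. i < n \<and> 0 < w i}"
  have "closed_states P S"
    unfolding closed_states_def
  proof (intro conjI ballI allI impI)
    show "S \<subseteq> {..<dim_row P}" using P'(2) by (auto simp: S_def)
    fix i j assume iS: "i \<in> S" and "j < dim_row P" and nz: "P $$ (i, j) \<noteq> 0"
    then have j: "j < n" and i: "i < n" "0 < w i" using P'(2) by (auto simp: S_def)
    have "0 < w i * P $$ (i, j)" using i nz P'(4)[OF i(1) j] by simp
    also have "\<dots> \<le> (\<Sum>i<n. w i * P $$ (i, j))"
      by (rule member_le_sum) (use i j nn P'(4) in auto)
    also have "\<dots> = w j" using w j by (simp add: left_fixed_def)
    finally show "j \<in> S" using j by (simp add: S_def)
  qed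
  moreover have "i \<in> S" using i nn[of i] by (simp add: S_def)
  ultimately have "S = {..<n}" using irr by blast
  then show ?thesis using j by (auto simp: S_def)
qed

lemma left_fixed_unique:
  assumes P: "row_stochastic n P"
    and irr: "\<And>S. closed_states P S \<Longrightarrow> S \<noteq> {} \<Longrightarrow> S = {..<n}"
    and d: "left_fixed n P d" and z: "(\<Sum>i<n. d i) = 0" and i: "i < n"
  shows "d i = 0"
proof -
  text \<open>The positive part of a fixed vector is again fixed, so it vanishes either nowhere or
    identically.\<close>
  have fix_pos: "left_fixed n P (\<lambda>i. \<bar>d i\<bar> + d i)"
    using left_fixed_abs[OF P d] d
    by (simp add: left_fixed_def distrib_right sum.distrib)
  have "d i \<le> 0" if i: "i < n" for i
  proof (rule ccontr)
    assume "\<not> d i \<le> 0"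
    then have "0 < \<bar>d j\<bar> + d j" if "j < n" for j
      by (intro left_fixed_nonneg_pos[OF P irr fix_pos, of i]) (use i that in auto)
    \<comment> \<open>A number \<open>t\<close> with \<open>0 < \<bar>t\<bar> + t\<close> is
      positive. One positive entry of \<open>d\<close> thus makes all entries positive, against
      total mass zero.\<close>
    then have "0 < d j" if "j < n" for j using that by fastforce
    then have "0 < (\<Sum>i<n. d i)" using i by (intro sum_pos) auto
    with z show False by simp
  qed
  then have "\<forall>j\<in>{..<n}. - d j = 0"
    using z by (subst sum_nonneg_eq_0_iff[symmetric]) (auto simp: sum_negf)
  then show ?thesis using i by simp
qed

text \<open>The eigenvalue 1 survives the passage to complex entries and gives the lower bound. For
  the upper bound, the eigenvalue equation is read at a coordinate of maximal modulus, which
  averaging cannot exceed.\<close>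

lemma spectral_radius_stochastic:
  assumes P: "row_stochastic n P" and n: "0 < n"
  shows "spectral_radius (map_mat complex_of_real P) = 1"
proof (rule antisym)
  note P' = row_stochasticD[OF P]
  let ?C = "map_mat complex_of_real P"
  have C: "?C \<in> carrier_mat n n" using P'(1) by simp
  obtain u where "eigenvector P u 1"
    using eigenvalue_one_stochastic[OF P n] unfolding eigenvalue_def by blast
  then have "eigenvalue ?C 1"
    using of_real_hom.eigenvector_hom[OF P'(1), of u 1] unfolding eigenvalue_def by auto
  then have "1 \<in> spectrum ?C" by (simp add: spectrum_def)
  then have "1 \<in> norm ` spectrum ?C" by (metis image_eqI norm_one)
  then show "1 \<le> spectral_radius ?C" by (rule spectral_radius_mem_max(2)[OF C n])
  obtain k where k: "eigenvalue ?C k" "spectral_radius ?C = norm k"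
    using spectral_radius_mem_max(1)[OF C n] by (auto simp: spectrum_def)
  then obtain w where w: "w \<in> carrier_vec n" "w \<noteq> 0\<^sub>v n" "?C *\<^sub>v w = k \<cdot>\<^sub>v w"
    using P'(2) by (auto simp: eigenvalue_def eigenvector_def)
  define m where "m = Max ((\<lambda>i. norm (w $ i)) ` {..<n})"
  have mle: "norm (w $ i) \<le> m" if "i < n" for i using that by (simp add: m_def)
  have "m \<in> (\<lambda>i. norm (w $ i)) ` {..<n}" unfolding m_def using n by (intro Max_in) auto
  then obtain i where i: "i < n" "norm (w $ i) = m" by auto
  obtain j where "j < n" "w $ j \<noteq> 0" using w(1,2) by (metis carrier_vecD eq_vecI index_zero_vec)
  then have m0: "0 < m" using mle[of j] by (meson zero_less_norm_iff less_le_trans)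
  have "k * w $ i = (\<Sum>j<n. complex_of_real (P $$ (i, j)) * w $ j)"
  proof -
    have "(?C *\<^sub>v w) $ i = (\<Sum>j<n. complex_of_real (P $$ (i, j)) * w $ j)"
      using i P' w(1) by (simp add: scalar_prod_def atLeast0LessThan)
    then show ?thesis using w i by simp
  qed
  then have "norm k * m \<le> (\<Sum>j<n. norm (complex_of_real (P $$ (i, j)) * w $ j))"
    using i(2) by (metis norm_mult norm_sum)
  also have "\<dots> \<le> (\<Sum>j<n. P $$ (i, j) * m)"
    using P'(4)[OF i(1)] mle by (intro sum_mono) (auto simp: norm_mult intro!: mult_left_mono)
  also have "\<dots> = m" using P'(5)[OF i(1)] by (simp flip: sum_distrib_right)
  finally show "spectral_radius ?C \<le> 1" using m0 k(2) by simp
qed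

lemma is_left_perron_vec_stochastic_iff:
  assumes P: "row_stochastic n P" and n: "0 < n"
  shows "is_left_perron_vec P q \<longleftrightarrow> q \<in> carrier_vec n \<and> left_fixed n P (($) q) \<and>
    (\<forall>i<n. 0 < q $ i) \<and> (\<Sum>i<n. q $ i) = 1"
proof (cases "q \<in> carrier_vec n")
  case True
  note P' = row_stochasticD[OF P]
  have "1 \<cdot>\<^sub>m mat_of_row q = mat_of_row q" by (rule eq_matI) auto
  moreover have "q \<bullet> ones_vec n = (\<Sum>i<n. q $ i)"
    by (simp add: ones_vec_def scalar_prod_def atLeast0LessThan)
  ultimately show ?thesis
    using True P' mat_of_row_mult_eq_iff[OF P'(1) True True]
    by (simp add: is_left_perron_vec_def spectral_radius_stochastic[OF P n] left_fixed_def
      pos_vec_def)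
qed (use row_stochasticD(2)[OF P] in \<open>simp add: is_left_perron_vec_def\<close>)

text \<open>\<open>left_perron_vec\<close> is a definite description, so existence and uniqueness
  are both due. The absolute values of a fixed vector, scaled to mass 1, give existence; the
  difference of two candidates is fixed with mass zero, hence zero.\<close>

lemma left_perron_vec_stochastic:
  assumes P: "row_stochastic n P" and n: "0 < n"
    and irr: "\<And>S. closed_states P S \<Longrightarrow> S \<noteq> {} \<Longrightarrow> S = {..<n}"
  shows "is_left_perron_vec P (left_perron_vec P)"
proof -
  note iff = is_left_perron_vec_stochastic_iff[OF P n]
  obtain w i where w: "left_fixed n P w" and i: "i < n" "w i \<noteq> 0"
    using exists_left_fixed[OF P n] by blast
  define s where "s = (\<Sum>i<n. \<bar>w i\<bar>)"
  have pos: "0 < \<bar>w j\<bar>" if "j < n" for j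
    by (rule left_fixed_nonneg_pos[OF P irr left_fixed_abs[OF P w], of i]) (use i that in auto)
  then have s0: "0 < s" unfolding s_def using n by (intro sum_pos) auto
  define q where "q = vec n (\<lambda>i. \<bar>w i\<bar> / s)"
  have "(\<Sum>i<n. q $ i * P $$ (i, j)) = q $ j" if "j < n" for j
    using left_fixed_abs[OF P w] that
    by (simp add: q_def left_fixed_def flip: sum_divide_distrib)
  moreover have "(\<Sum>i<n. q $ i) = 1"
    using s0 by (simp add: q_def s_def flip: sum_divide_distrib)
  ultimately have q: "is_left_perron_vec P q"
    unfolding iff using pos s0 by (simp add: left_fixed_def) (simp add: q_def)
  have "r = q" if r: "is_left_perron_vec P r" for r
  proof (rule eq_vecI)
    have "left_fixed n P (\<lambda>i. r $ i - q $ i)"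
      using r q unfolding iff by (simp add: left_fixed_def left_diff_distrib sum_subtractf)
    moreover have "(\<Sum>i<n. r $ i - q $ i) = 0"
      using r q unfolding iff by (simp add: sum_subtractf)
    ultimately have "r $ i - q $ i = 0" if "i < n" for i
      using left_fixed_unique[OF P irr] that by blast
    then show "r $ i = q $ i" if "i < dim_vec q" for i using that by (simp add: q_def)
    show "dim_vec r = dim_vec q" using r unfolding iff by (simp add: q_def)
  qed
  then show ?thesis unfolding left_perron_vec_def
    by (intro theI[of "is_left_perron_vec P", OF q])
qed

text \<open>Multiplying the recurrence by \<open>w\<close> from the left gives
  \<open>w X = (1 - l) w + l w P X = (1 - l) w + l w X\<close>, and \<open>1 - l\<close>
  cancels.\<close>

lemma left_fixed_X_matrix:
  assumes P: "row_stochastic n P" and l: "0 < l" "l < 1" and w: "left_fixed n P w"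
  shows "left_fixed n (X_matrix P l) w"
  unfolding left_fixed_def
proof (intro allI impI)
  fix j assume j: "j < n"
  let ?X = "X_matrix P l"
  have "(\<Sum>i<n. w i * ?X $$ (i, j)) = (\<Sum>i<n. w i * ((1 - l) * (if i = j then 1 else 0) +
      l * (\<Sum>k<n. P $$ (i, k) * ?X $$ (k, j))))"
    by (intro sum.cong refl arg_cong2[where f="(*)"] X_matrix_entry[OF P l _ j]) simp
  also have "\<dots> = (\<Sum>i<n. if i = j then (1 - l) * w i else 0) +
      (\<Sum>i<n. l * (\<Sum>k<n. w i * P $$ (i, k) * ?X $$ (k, j)))"
    unfolding sum.distrib[symmetric]
    by (rule sum.cong) (auto simp: distrib_left sum_distrib_left mult_ac)
  also have "\<dots> = (1 - l) * w j + l * (\<Sum>i<n. \<Sum>k<n. w i * P $$ (i, k) * ?X $$ (k, j))"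
    using j by (simp add: sum_distrib_left)
  also have "(\<Sum>i<n. \<Sum>k<n. w i * P $$ (i, k) * ?X $$ (k, j)) = (\<Sum>k<n. w k * ?X $$ (k, j))"
    using w by (subst sum.swap) (simp add: left_fixed_def flip: sum_distrib_right)
  finally have "(1 - l) * (\<Sum>i<n. w i * ?X $$ (i, j)) = (1 - l) * w j"
    by (simp add: algebra_simps)
  then show "(\<Sum>i<n. w i * ?X $$ (i, j)) = w j" using l by simp
qed

section \<open>Row-normalization of a block triangular matrix\<close>

lemma sum_lessThan_add:
  fixes f :: "nat \<Rightarrow> 'a::comm_monoid_add"
  shows "(\<Sum>i<m + n. f i) = (\<Sum>i<m. f i) + (\<Sum>i<n. f (m + i))"
  by (induction n) (simp_all add: add.assoc)

lemma nonneg_row_sum_pos: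
  assumes A: "A \<in> carrier_mat n n" "0\<^sub>m n n \<le> A" "no_zero_row A" and i: "i < n"
  shows "0 < (\<Sum>j<n. A $$ (i, j))"
proof -
  have nn: "0 \<le> A $$ (i, j)" if "j < n" for j
    using A(1,2) i that by (auto simp: less_eq_mat_def)
  have "row A i \<noteq> 0\<^sub>v n" using A(1,3) i by (auto simp: no_zero_row_def)
  then have "\<exists>j<n. A $$ (i, j) \<noteq> 0" using A(1) i by (auto intro!: eq_vecI)
  then obtain j where j: "j < n" "A $$ (i, j) \<noteq> 0" by blast
  then show ?thesis using nn by (intro sum_pos2[of _ j]) (auto simp: order_less_le)
qed

lemma row_normalize_index:
  assumes "A \<in> carrier_mat n n" "i < n" "j < n"
  shows "row_normalize A $$ (i, j) = A $$ (i, j) / (\<Sum>k<n. A $$ (i, k))"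
  using assms by (simp add: row_normalize_def)

lemma row_normalize_stochastic:
  assumes A: "A \<in> carrier_mat n n" "0\<^sub>m n n \<le> A" "no_zero_row A"
  shows "row_stochastic n (row_normalize A)"
  unfolding row_stochastic_def
proof (intro conjI allI impI)
  note index = row_normalize_index[OF A(1)] and pos = nonneg_row_sum_pos[OF A]
  show "row_normalize A \<in> carrier_mat n n" using A(1) by (simp add: row_normalize_def)
  show "0 \<le> row_normalize A $$ (i, j)" if "i < n" "j < n" for i j
    using A(1,2) that pos[of i] by (auto simp: index less_eq_mat_def)
  show "(\<Sum>j<n. row_normalize A $$ (i, j)) = 1" if "i < n" for i
    using that pos[of i] by (simp add: index flip: sum_divide_distrib)
qed

text \<open>Division by positive row sums keeps the pattern of nonzero entries, so irreducibility of
  a matrix can be used for its normalization.\<close>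

lemma closed_states_row_normalize:
  assumes A: "A \<in> carrier_mat n n" "0\<^sub>m n n \<le> A" "no_zero_row A"
    and S: "closed_states (row_normalize A) S"
  shows "closed_states A S"
  unfolding closed_states_def
proof (intro conjI ballI allI impI)
  have dim: "dim_row (row_normalize A) = n" using A(1) by (simp add: row_normalize_def)
  show "S \<subseteq> {..<dim_row A}" using S A(1) dim by (simp add: closed_states_def)
  fix i j assume "i \<in> S" "j < dim_row A" "A $$ (i, j) \<noteq> 0"
  moreover from this have "i < n" "j < n" using S A(1) dim by (auto simp: closed_states_def)
  ultimately show "j \<in> S"
    using S dim row_normalize_index[OF A(1)] nonneg_row_sum_pos[OF A, of i]
    by (auto simp: closed_states_def)
qed

section \<open>Access to the last block and the zero-padded Perron vector\<close>

locale block_triangular =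
  fixes A A2 B :: "real mat" and N n1 n2 :: nat
  assumes N: "n1 + n2 = N"
    and A: "A \<in> carrier_mat N N" "0\<^sub>m N N \<le> A" "no_zero_row A"
    and A2: "A2 \<in> carrier_mat n2 n2" "irreducible_matrix A2"
    and B: "B \<in> carrier_mat n1 n2"
    and block: "A = four_block_mat (0\<^sub>m n1 n1) B (0\<^sub>m n2 n1) A2"
begin

lemma A_index:
  shows "i < N \<Longrightarrow> j < n1 \<Longrightarrow> A $$ (i, j) = 0"
    and "i < n2 \<Longrightarrow> j < n2 \<Longrightarrow> A $$ (n1 + i, n1 + j) = A2 $$ (i, j)"
  using N A2(1) B by (simp_all add: block)

lemma n2_pos: "0 < n2"
  using A2 by (auto simp: irreducible_matrix_def)

text \<open>The lower rows of \<open>A\<close> vanish in the first \<open>n1\<close> columns. Equal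
  row sums are what makes the lower right block of \<open>P\<close> coincide with
  \<open>P2\<close>.\<close>

lemma A2_row_sum: "i < n2 \<Longrightarrow> (\<Sum>j<n2. A2 $$ (i, j)) = (\<Sum>j<N. A $$ (n1 + i, j))"
  by (simp add: sum_lessThan_add A_index flip: N)

lemma A2_nonneg: "0\<^sub>m n2 n2 \<le> A2"
proof -
  have "0 \<le> A2 $$ (i, j)" if "i < n2" "j < n2" for i j
    using A(1,2) N that by (auto simp: less_eq_mat_def simp flip: A_index(2))
  then show ?thesis using A2(1) by (auto simp: less_eq_mat_def)
qed

lemma A2_no_zero_row: "no_zero_row A2"
  unfolding no_zero_row_def
proof (intro allI impI)
  fix i assume "i < dim_row A2"
  then have i: "i < n2" using A2(1) by simp
  have "0 < (\<Sum>j<n2. A2 $$ (i, j))"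
    using nonneg_row_sum_pos[OF A, of "n1 + i"] A2_row_sum[OF i] i N by simp
  then have "\<exists>j<n2. A2 $$ (i, j) \<noteq> 0" by (metis lessThan_iff less_irrefl sum.neutral)
  then obtain j where j: "j < n2" "row A2 i $ j \<noteq> 0" using A2(1) i by auto
  then show "row A2 i \<noteq> 0\<^sub>v (dim_col A2)" using A2(1) by auto
qed

abbreviation "P \<equiv> row_normalize A"
abbreviation "P2 \<equiv> row_normalize A2"

lemma P_stochastic: "row_stochastic N P"
  by (rule row_normalize_stochastic[OF A])

lemma P2_stochastic: "row_stochastic n2 P2"
  by (rule row_normalize_stochastic[OF A2(1) A2_nonneg A2_no_zero_row])

lemma P_index:
  shows "i < N \<Longrightarrow> j < n1 \<Longrightarrow> P $$ (i, j) = 0"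
    and "i < n2 \<Longrightarrow> j < n2 \<Longrightarrow> P $$ (n1 + i, n1 + j) = P2 $$ (i, j)"
  using N by (auto simp: row_normalize_index[OF A(1)] row_normalize_index[OF A2(1)] A_index
    A2_row_sum)

lemma P2_irreducible:
  assumes "closed_states P2 S" "S \<noteq> {}"
  shows "S = {..<n2}"
  using irreducible_closed_states[OF A2(2) closed_states_row_normalize assms(2)] assms(1)
    A2(1) A2_nonneg A2_no_zero_row by auto

text \<open>Index \<open>n1\<close> is the first state of the last block. Every row of
  \<open>P\<close> has a nonzero entry, and none lies in the first \<open>n1\<close> columns, so one
  step from any state enters the last block. The trace of \<open>S\<close> there is closed under
  \<open>P2\<close> and nonempty, hence the whole block.\<close>

lemma first_state_accessible:
  assumes S: "closed_states P S" and ne: "S \<noteq> {}"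
  shows "n1 \<in> S"
proof -
  note P' = row_stochasticD[OF P_stochastic] and P2' = row_stochasticD[OF P2_stochastic]
  define S2 where "S2 = {i. i < n2 \<and> n1 + i \<in> S}"
  have "closed_states P2 S2"
    unfolding closed_states_def
  proof (intro conjI ballI allI impI)
    show "S2 \<subseteq> {..<dim_row P2}" using P2'(2) by (auto simp: S2_def)
    fix i j assume "i \<in> S2" "j < dim_row P2" and nz: "P2 $$ (i, j) \<noteq> 0"
    then have ij: "i < n2" "n1 + i \<in> S" "j < n2" using P2'(2) by (auto simp: S2_def)
    have "P $$ (n1 + i, n1 + j) \<noteq> 0" using nz P_index(2) ij by simp
    then have "n1 + j \<in> S" using S ij P'(2) N unfolding closed_states_def by fastforce
    then show "j \<in> S2" using ij by (simp add: S2_def)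
  qed
  then have S2: "S2 = {..<n2}" if "S2 \<noteq> {}" using P2_irreducible that by blast
  obtain s where s: "s \<in> S" "s < N"
    using ne S P'(2) by (auto simp: closed_states_def)
  have "\<exists>t<N. P $$ (s, t) \<noteq> 0"
  proof (rule ccontr)
    assume "\<not> ?thesis"
    then have "(\<Sum>t<N. P $$ (s, t)) = 0" by (intro sum.neutral) auto
    then show False using P'(5)[OF s(2)] by simp
  qed
  then obtain t where t: "t < N" "P $$ (s, t) \<noteq> 0" by blast
  then have "t \<in> S" using S s P'(2) by (auto simp: closed_states_def)
  moreover have "n1 \<le> t" using P_index(1)[OF s(2), of t] t(2) by (meson not_less)
  ultimately have "t - n1 \<in> S2" using t N by (auto simp: S2_def)
  then have "0 \<in> S2" using S2 n2_pos by blast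
  then show ?thesis by (simp add: S2_def)
qed

text \<open>The zero columns of \<open>P\<close> reproduce the padding, and on the last block
  \<open>P\<close> acts as \<open>P2\<close>, which fixes \<open>q\<close>.\<close>

lemma perron_extension_left_fixed:
  defines "q \<equiv> left_perron_vec P2"
  shows "dim_vec q = n2" and "left_fixed N P (($) (0\<^sub>v n1 @\<^sub>v q))"
    and "(\<Sum>i<N. (0\<^sub>v n1 @\<^sub>v q) $ i) = 1"
proof -
  have q: "q \<in> carrier_vec n2" "left_fixed n2 P2 (($) q)" "(\<Sum>i<n2. q $ i) = 1"
    using left_perron_vec_stochastic[OF P2_stochastic n2_pos P2_irreducible]
    unfolding q_def is_left_perron_vec_stochastic_iff[OF P2_stochastic n2_pos] by auto
  show "dim_vec q = n2" using q(1) by simp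
  let ?c = "0\<^sub>v n1 @\<^sub>v q"
  have c: "i < n1 \<Longrightarrow> ?c $ i = 0" "j < n2 \<Longrightarrow> ?c $ (n1 + j) = q $ j" for i j
    using q(1) by auto
  have "(\<Sum>i<N. ?c $ i * P $$ (i, j)) = ?c $ j" if j: "j < N" for j
  proof (cases "j < n1")
    case True
    then show ?thesis by (simp add: P_index(1) c)
  next
    case False
    then obtain m where m: "j = n1 + m" "m < n2" using j N
      by (metis add_less_cancel_left le_Suc_ex not_less)
    then have "(\<Sum>i<N. ?c $ i * P $$ (i, j)) = (\<Sum>i<n2. q $ i * P2 $$ (i, m))"
      by (simp add: sum_lessThan_add c P_index(2) flip: N)
    then show ?thesis using q(2) m by (simp add: left_fixed_def c)
  qed
  then show "left_fixed N P (($) ?c)" by (simp add: left_fixed_def)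
  show "(\<Sum>i<N. ?c $ i) = 1" using q(3) by (simp add: sum_lessThan_add c flip: N)
qed

end

theorem theorem4:
  fixes A A2 B :: "real mat" and N n1 n2 :: nat and l :: real
    and v :: "real vec" and x :: "nat \<Rightarrow> real vec"
  assumes "n1 + n2 = N"
    and "A \<in> carrier_mat N N" and "0\<^sub>m N N \<le> A" and "reducible_matrix A" and "no_zero_row A"
    and "A2 \<in> carrier_mat n2 n2" and "0\<^sub>m n2 n2 \<le> A2" and "irreducible_matrix A2"
    and "B \<in> carrier_mat n1 n2" and "0\<^sub>m n1 n2 \<le> B"
    and "A = four_block_mat (0\<^sub>m n1 n1) B (0\<^sub>m n2 n1) A2"
    and "0 < l" and "l < 1"
    and "personalization_vec N v" and "vec_norm1 v = 1"
    and "x 0 = v"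
    and "\<And>k. 1 \<le> k \<Longrightarrow>
           mat_of_row (x k) = mat_of_row (x (k - 1)) * X_matrix (row_normalize A) l"
  shows "(\<forall>k\<ge>1. mat_of_row (x k) = mat_of_row v * (X_matrix (row_normalize A) l ^\<^sub>m k)) \<and>
         vec_tendsto x (0\<^sub>v n1 @\<^sub>v left_perron_vec (row_normalize A2))"
proof -
  interpret block_triangular A A2 B N n1 n2
    by unfold_locales (use assms in auto)
  let ?X = "X_matrix P l"
  note l = \<open>0 < l\<close> \<open>l < 1\<close>
  note X' = row_stochasticD[OF X_matrix_stochastic[OF P_stochastic l]]
  have rec: "mat_of_row (x (Suc k)) = mat_of_row (x k) * ?X" for k
    using assms(17)[of "Suc k"] by simp
  have v: "v \<in> carrier_vec N" "(\<Sum>i<N. v $ i) = 1"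
    using assms(14) by (auto simp: personalization_vec_def ones_vec_def scalar_prod_def
      atLeast0LessThan)
  \<comment> \<open>The recursion determines the length of each later iterate: it is the number of
    columns of the product of row matrices.\<close>
  have dim: "x k \<in> carrier_vec N" for k
  proof (cases k)
    case (Suc m)
    have "dim_vec (x (Suc m)) = dim_col (mat_of_row (x m) * ?X)" unfolding rec[symmetric] by simp
    then show ?thesis using X'(3) Suc by (auto intro: carrier_vecI)
  qed (use assms(16) v in simp)
  have power: "mat_of_row (x k) = mat_of_row v * (?X ^\<^sub>m k)" for k
  proof (induction k)
    case 0
    then show ?case using v(1) X'(2) assms(16) right_mult_one_mat[of "mat_of_row v" 1 N] by auto
  next
    case (Suc k)
    then show ?case
      unfolding rec using assoc_mult_mat[of "mat_of_row v" 1 N "?X ^\<^sub>m k" N ?X N] v(1) X'(1)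
      by auto
  qed
  let ?q = "left_perron_vec P2"
  note q = perron_extension_left_fixed
  have "(\<lambda>k. x k $ m) \<longlonglongrightarrow> (0\<^sub>v n1 @\<^sub>v ?q) $ m" if m: "m < N" for m
  \<comment> \<open>The positive column is \<open>n1\<close>, and both \<open>v\<close> and the
    padded Perron vector have total mass 1.\<close>
  proof (rule doeblin_convergence[where y="\<lambda>k i. x k $ i",
        OF X_matrix_stochastic[OF P_stochastic l] _ _ _ _ _ m])
    show "n1 < N" using N n2_pos by simp
    then show "0 < ?X $$ (i, n1)" if "i < N" for i
      using X_matrix_column_pos[OF P_stochastic l _ first_state_accessible that] by blast
    show "x (Suc k) $ m = (\<Sum>i<N. x k $ i * ?X $$ (i, m))" if "m < N" for k m
      using mat_of_row_mult_eq_iff[OF X'(1) dim dim, of k "Suc k"] rec[of k] that by simp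
    show "(0\<^sub>v n1 @\<^sub>v ?q) $ m = (\<Sum>i<N. (0\<^sub>v n1 @\<^sub>v ?q) $ i * ?X $$ (i, m))" if "m < N" for m
      using left_fixed_X_matrix[OF P_stochastic l q(2)] that unfolding left_fixed_def by metis
    show "(\<Sum>i<N. x 0 $ i) = (\<Sum>i<N. (0\<^sub>v n1 @\<^sub>v ?q) $ i)"
      using v(2) q(3) assms(16) by simp
  qed
  moreover have "dim_vec (0\<^sub>v n1 @\<^sub>v ?q) = N" using q(1) N by simp
  ultimately have "vec_tendsto x (0\<^sub>v n1 @\<^sub>v ?q)"
    unfolding vec_tendsto_def using dim carrier_vecD by metis
  then show ?thesis using power by blast
qed

end
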